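(* For every $t=1,\dots,T$ and every $I[t-1]\in\mathcal{I}_{t-1}$, the optimal cost-to-go $P[t]\mapsto J_t^*(P[t],I[t-1])$ of the hybrid system minimizing the cost function $\sum_{t=1}^T\big(Q(P[t],I[t])+\kappa(I[t-1],I[t])\big)$ is continuous with respect to $P[t]$ (on $\mathcal{P}_t$).
   Context: Data. There are $N$ thermal units and $T$ time periods. The commitment vector at time $t$ is $I[t]=(I_1[t],\dots,I_N[t])\in\{0,1\}^N$ and the power vector is $P[t]=(P_1[t],\dots,P_N[t],P_{DG}[t],P_{DR}[t])\in\mathbb{R}^{N+2}$ (thermal outputs, aggregated distributed generation, curtailed demand). Given are the demands $P_D[t]$, the upper limits $P^M_{DG}[t]$ and $P^M_{DR}[t]$, the spinning reserves $R^m[t],R^M[t]>0$, the capacities $0<P^m_n\le P^M_n$, the ramp limits $R^D_n,R^U_n$, the maximal penetration rate $\eta_{\max}$, the emission price $p_e\ge 0$, the emission quotas $Q_n$, the cost constants $C_{b,n},C_{f,n},C_{D,n}$, and initial data $P[0],I[0]$. The sequences $P_D[t]$ and $P^M_{DG}[t]$ are given exogenously (by forecasting models). Costs. $C_{F,n}(x)=a_nx^2+b_nx+c_n$, $E_n(x)=\alpha_nx^2+\beta_nx+\gamma_n$, $C_{DG}(x)=a_{DG}x^2+b_{DG}x+c_{DG}$, $C_{DR}(x)=a_{DR}x^2+b_{DR}x+c_{DR}$. These are strictly convex quadratics: $a_n,\alpha_n,a_{DG},a_{DR}>0$. The running cost is $$Q(P[t],I[t])=\sum_{n=1}^N\Big(I_n[t]\big(C_{F,n}(P_n[t])+p_eE_n(P_n[t])\big)-\tfrac{1}{T}Q_np_e\Big)+C_{DG}(P_{DG}[t])+C_{DR}(P_{DR}[t]),$$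 and the switching cost is $\kappa(I[t-1],I[t])=\sum_{n=1}^N\kappa_n(I[t-1],I[t])$ with $$\kappa_n(I[t-1],I[t])=C_{b,n}+(C_{f,n}-C_{b,n}+C_{D,n})I_n[t-1]-(C_{f,n}+C_{D,n})I_n[t-1]I_n[t].$$ Lower-level problem at time $t$. Given $I\in\{0,1\}^N$ and $P[t-1]$, minimize $Q(P[t],I)$ over $P[t]\in\mathbb{R}^{N+2}$ subject to, for all $n$: - $\sum_n P_n[t]I_n+P_{DG}[t]+P_{DR}[t]=P_D[t]$; - $\sum_nP^m_nI_n+P_{DG}[t]+P_{DR}[t]\le P_D[t]-R^m[t]$; - $\sum_nP^M_nI_n+P_{DG}[t]+P_{DR}[t]\ge P_D[t]+R^M[t]$; - $I_nP^m_n\le P_n[t]\le I_nP^M_n$; - ramp limit: $-R^D_n\le P_n[t]-P_n[t-1]\le R^U_n$ whenever $I_n=1$ and unit $n$ was committed at time $t-1$, which is read off from $P[t-1]$ as $P_n[t-1]>0$; - $0\le P_{DG}[t]\le P^M_{DG}[t]$; - $(1-\eta_{\max})P_{DG}[t]\le\eta_{\max}\sum_nP_n[t]$ (penetration rate limit); - $0\le P_{DR}[t]\le P^M_{DR}[t]$. Its (unique) optimal solution is denoted $f_I(P[t-1],P^M_{DG}[t],P_D[t])$, abbreviated $f_I(P[t-1])$; the equations $P[t]=f_{I}(P[t-1],P^M_{DG}[t],P_D[t])$ constitute the hybrid system with subsystems indexed by $I$. Feasible sets. Put $\mathcal{P}_0=\{P[0]\}$ and $\mathcal{I}_0=\{I[0]\}$.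 For $t\ge1$, $\mathcal{I}_t$ is the set of $I\in\{0,1\}^N$ for which the lower-level problem at time $t$ admits a solution (for every $P[t-1]\in\mathcal{P}_{t-1}$), so that $f_I$ is defined on $\mathcal{P}_{t-1}$ for all $I\in\mathcal{I}_t$. $\mathcal{P}_t$ is the set of power vectors feasible for the lower-level problem at time $t$ for some $I\in\mathcal{I}_t$ and some $P[t-1]\in\mathcal{P}_{t-1}$. Optimal cost-to-go. $J^*_{T+1}:=0$, and for $t=T,\dots,1$, $P[t]\in\mathcal{P}_t$, $I[t-1]\in\mathcal{I}_{t-1}$, $$J_t^*(P[t],I[t-1])=\min_{I[t]}\Big(Q(P[t],I[t])+\kappa(I[t-1],I[t])+J^*_{t+1}\big(f_{I[t]}(P[t]),I[t]\big)\Big),$$ where $f_{I[t]}(P[t])=f_{I[t]}(P[t],P^M_{DG}[t+1],P_D[t+1])$. The minimum is over all $I[t]\in\mathcal{I}_t$ for which the expression is defined (i.e. also $I[t]\in\mathcal{I}_{t+1}$ when $t<T$; for $t=T$ the last term is $0$), this set of admissible $I[t]$ being nonempty. *)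

theory Defs
  imports "HOL-Analysis.Analysis"
begin

text \<open>The units are the elements of the finite type \<^typ>\<open>'n\<close>, so \<open>N = CARD('n)\<close>. Fields of type
  \<^typ>\<open>nat \<Rightarrow> real\<close> are indexed by the time period.\<close>

type_synonym 'n commitment = "real ^ 'n"

text \<open>A power vector in \<open>\<real>\<^bsup>N+2\<^esup>\<close>: thermal outputs, distributed generation, curtailed demand.\<close>

type_synonym 'n power = "(real ^ 'n) \<times> real \<times> real"

abbreviation P_th :: "'n::finite power \<Rightarrow> 'n \<Rightarrow> real" where
  "P_th P n \<equiv> fst P $ n"

abbreviation P_DG :: "'n::finite power \<Rightarrow> real" where
  "P_DG P \<equiv> fst (snd P)"

abbreviation P_DR :: "'n::finite power \<Rightarrow> real" where
  "P_DR P \<equiv> snd (snd P)"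

definition commitments :: "'n::finite commitment set" where
  "commitments = {I. \<forall>n. I $ n \<in> {0, 1}}"

record ('n::finite) uc_data =
  horizon :: nat
  demand :: "nat \<Rightarrow> real"
  DG_max :: "nat \<Rightarrow> real"
  DR_max :: "nat \<Rightarrow> real"
  reserve_down :: "nat \<Rightarrow> real" \<comment> \<open>\<open>R\<^sup>m\<close>\<close>
  reserve_up :: "nat \<Rightarrow> real" \<comment> \<open>\<open>R\<^sup>M\<close>\<close>
  P_min :: "'n \<Rightarrow> real"
  P_max :: "'n \<Rightarrow> real"
  ramp_down :: "'n \<Rightarrow> real"
  ramp_up :: "'n \<Rightarrow> real"
  eta_max :: real
  emission_price :: real
  quota :: "'n \<Rightarrow> real"
  C_b :: "'n \<Rightarrow> real"
  C_f :: "'n \<Rightarrow> real"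
  C_D :: "'n \<Rightarrow> real"
  fuel_a :: "'n \<Rightarrow> real"
  fuel_b :: "'n \<Rightarrow> real"
  fuel_c :: "'n \<Rightarrow> real"
  em_alpha :: "'n \<Rightarrow> real"
  em_beta :: "'n \<Rightarrow> real"
  em_gamma :: "'n \<Rightarrow> real"
  a_DG :: real
  b_DG :: real
  c_DG :: real
  a_DR :: real
  b_DR :: real
  c_DR :: real
  P_init :: "'n power"
  I_init :: "'n commitment"

definition uc_data_valid :: "'n::finite uc_data \<Rightarrow> bool" where
  "uc_data_valid D \<longleftrightarrow>
     (\<forall>t\<in>{1..horizon D}. 0 < reserve_down D t \<and> 0 < reserve_up D t) \<and>
     (\<forall>n. 0 < P_min D n \<and> P_min D n \<le> P_max D n) \<and>
     0 \<le> emission_price D \<and>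
     (\<forall>n. 0 < fuel_a D n \<and> 0 < em_alpha D n) \<and>
     0 < a_DG D \<and> 0 < a_DR D \<and>
     I_init D \<in> commitments"

definition fuel_cost :: "'n::finite uc_data \<Rightarrow> 'n \<Rightarrow> real \<Rightarrow> real" where
  "fuel_cost D n x = fuel_a D n * x\<^sup>2 + fuel_b D n * x + fuel_c D n"

definition emission :: "'n::finite uc_data \<Rightarrow> 'n \<Rightarrow> real \<Rightarrow> real" where
  "emission D n x = em_alpha D n * x\<^sup>2 + em_beta D n * x + em_gamma D n"

definition DG_cost :: "'n::finite uc_data \<Rightarrow> real \<Rightarrow> real" where
  "DG_cost D x = a_DG D * x\<^sup>2 + b_DG D * x + c_DG D"

definition DR_cost :: "'n::finite uc_data \<Rightarrow> real \<Rightarrow> real" where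
  "DR_cost D x = a_DR D * x\<^sup>2 + b_DR D * x + c_DR D"

definition running_cost :: "'n::finite uc_data \<Rightarrow> 'n power \<Rightarrow> 'n commitment \<Rightarrow> real" where
  "running_cost D P I =
     (\<Sum>n\<in>UNIV. I $ n * (fuel_cost D n (P_th P n) + emission_price D * emission D n (P_th P n))
        - 1 / real (horizon D) * quota D n * emission_price D)
     + DG_cost D (P_DG P) + DR_cost D (P_DR P)"

definition switching_cost ::
    "'n::finite uc_data \<Rightarrow> 'n commitment \<Rightarrow> 'n commitment \<Rightarrow> real" where
  "switching_cost D I' I =
     (\<Sum>n\<in>UNIV. C_b D n + (C_f D n - C_b D n + C_D D n) * I' $ n
        - (C_f D n + C_D D n) * I' $ n * I $ n)"

text \<open>\<open>feasible D t I P' P\<close>: the vector \<open>P\<close> satisfies the constraints of the lower-level problem at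
  time \<open>t\<close> under commitment \<open>I\<close>, where \<open>P'\<close> is the power vector at time \<open>t - 1\<close>. That unit \<open>n\<close> was
  committed at time \<open>t - 1\<close> is read off from \<open>P'\<close>.\<close>

definition feasible ::
    "'n::finite uc_data \<Rightarrow> nat \<Rightarrow> 'n commitment \<Rightarrow> 'n power \<Rightarrow> 'n power \<Rightarrow> bool" where
  "feasible D t I P' P \<longleftrightarrow>
     (\<Sum>n\<in>UNIV. P_th P n * I $ n) + P_DG P + P_DR P = demand D t \<and>
     (\<Sum>n\<in>UNIV. P_min D n * I $ n) + P_DG P + P_DR P \<le> demand D t - reserve_down D t \<and>
     (\<Sum>n\<in>UNIV. P_max D n * I $ n) + P_DG P + P_DR P \<ge> demand D t + reserve_up D t \<and>
     (\<forall>n. I $ n * P_min D n \<le> P_th P n \<and> P_th P n \<le> I $ n * P_max D n) \<and>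
     (\<forall>n. I $ n = 1 \<and> P_th P' n > 0 \<longrightarrow>
        - ramp_down D n \<le> P_th P n - P_th P' n \<and> P_th P n - P_th P' n \<le> ramp_up D n) \<and>
     0 \<le> P_DG P \<and> P_DG P \<le> DG_max D t \<and>
     (1 - eta_max D) * P_DG P \<le> eta_max D * (\<Sum>n\<in>UNIV. P_th P n) \<and>
     0 \<le> P_DR P \<and> P_DR P \<le> DR_max D t"

definition optimal ::
    "'n::finite uc_data \<Rightarrow> nat \<Rightarrow> 'n commitment \<Rightarrow> 'n power \<Rightarrow> 'n power \<Rightarrow> bool" where
  "optimal D t I P' P \<longleftrightarrow> is_arg_min (\<lambda>X. running_cost D X I) (feasible D t I P') P"

text \<open>The subsystem map \<open>f\<^sub>I\<close> for the transition from time \<open>t - 1\<close> to time \<open>t\<close>; the exogenous data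
  \<open>P\<^sup>M\<^sub>D\<^sub>G[t]\<close> and \<open>P\<^sub>D[t]\<close> enter through \<open>t\<close>.\<close>

definition subsystem ::
    "'n::finite uc_data \<Rightarrow> nat \<Rightarrow> 'n commitment \<Rightarrow> 'n power \<Rightarrow> 'n power" where
  "subsystem D t I P' = (THE P. optimal D t I P' P)"

function power_set :: "'n::finite uc_data \<Rightarrow> nat \<Rightarrow> 'n power set"
  and commitment_set :: "'n::finite uc_data \<Rightarrow> nat \<Rightarrow> 'n commitment set" where
  "power_set D 0 = {P_init D}"
| "power_set D (Suc t) =
     {P. \<exists>I\<in>commitment_set D (Suc t). \<exists>P'\<in>power_set D t. feasible D (Suc t) I P' P}"
| "commitment_set D 0 = {I_init D}"
| "commitment_set D (Suc t) =
     {I\<in>commitments. \<forall>P'\<in>power_set D t. \<exists>P. optimal D (Suc t) I P' P}"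
  by pat_completeness auto
termination
  by (relation "Wellfounded.measure (case_sum (\<lambda>(D, t). 2 * t + 1) (\<lambda>(D, t). 2 * t))") auto

text \<open>At time \<open>t < T\<close> the commitment \<open>I[t]\<close> also selects the subsystem leading to time \<open>t + 1\<close>, hence
  has to belong to the commitment sets of both times.\<close>

definition admissible :: "'n::finite uc_data \<Rightarrow> nat \<Rightarrow> 'n commitment set" where
  "admissible D t =
     (if t < horizon D then commitment_set D t \<inter> commitment_set D (Suc t)
      else commitment_set D t)"

text \<open>\<open>cost_to_go D t P I'\<close> is \<open>J\<^sub>t\<^sup>*(P[t], I[t-1])\<close> with \<open>P = P[t]\<close> and \<open>I' = I[t-1]\<close>.
  For \<open>t = T\<close> the value of \<^const>\<open>subsystem\<close> is irrelevant, as the last summand vanishes.\<close>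

function cost_to_go ::
    "'n::finite uc_data \<Rightarrow> nat \<Rightarrow> 'n power \<Rightarrow> 'n commitment \<Rightarrow> real" where
  "cost_to_go D t P I' =
     (if t > horizon D then 0
      else Min ((\<lambda>I. running_cost D P I + switching_cost D I' I
                   + cost_to_go D (Suc t) (subsystem D (Suc t) I P) I) ` admissible D t))"
  by pat_completeness auto
termination
  by (relation "Wellfounded.measure (\<lambda>(D, t, P, I'). Suc (horizon D) - t)") auto

declare cost_to_go.simps [simp del]

end

theory Submission
  imports Defs
begin

text \<open>
  The cost-to-go at time \<open>t\<close> is a minimum of finitely many functions of \<open>P[t]\<close>, each the sum of a
  quadratic, a constant and the next cost-to-go evaluated at \<open>f\<^sub>I(P[t])\<close>. By backward induction over
  time everything therefore reduces to the continuity of the subsystem maps \<open>f\<^sub>I\<close> on the feasible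
  sets (\<open>continuous_subsystem\<close>).

  The map \<open>f\<^sub>I\<close> sends the previous power vector \<open>P'\<close> to the minimizer of a convex quadratic over the
  vectors compatible with \<open>P'\<close>. The dependence on \<open>P'\<close> has two sources. The set of
  units subject to a ramp limit depends on the signs of the thermal outputs, which looks
  discontinuous; but on a feasible set a thermal output is either \<open>0\<close> or at least the positive
  minimal capacity, so this set of units is locally constant. Once it is fixed, all constraints are
  linear inequalities in the pair \<open>(P', P)\<close>, and \<open>f\<^sub>I(P')\<close> is the minimizer of the cost over the
  fibre above \<open>P'\<close> of one polytope. The minimizer is unique because a midpoint of two
  distinct minimizers would be strictly cheaper (\<open>optimal_unique\<close>).

  What remains is a fact about polytopes (\<open>continuous_on_unique_minimizer\<close>): a unique minimizer over
  the fibres of a polytope depends continuously on the base point. Limits of minimizers lie in the limiting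
  fibre because the polytope is closed. They are minimizers there provided that every point of
  the limiting fibre is a limit of points of the nearby fibres. This would fail for general compact
  convex sets; for a polytope it holds (\<open>polytope_fibre_calm\<close>) because the projection of the
  polytope is again a polytope, and a polytope coincides near each of its points with a cone.
\<close>

section \<open>Fibres of a polytope\<close>

text \<open>The step length \<open>e\<close> works for all directions at once: a defining inequality that is tight at \<open>p\<close>
  can only improve or stay tight in the direction of a point of \<open>K\<close>, hence never limits the step, and
  each of the finitely many others leaves a positive slack.\<close>

lemma polyhedron_locally_conic:
  fixes K :: "'a::euclidean_space set"
  assumes "polyhedron K" and "p \<in> K"
  shows "\<exists>e>0. \<forall>q\<in>K. q \<noteq> p \<longrightarrow> p + (e / norm (q - p)) *\<^sub>R (q - p) \<in> K"
proof -
  obtain F where F: "finite F" "K = \<Inter>F"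
    and half: "\<forall>h\<in>F. \<exists>a b. a \<noteq> 0 \<and> h = {x. a \<bullet> x \<le> b}"
    using assms(1) unfolding polyhedron_def by blast
  have "\<forall>\<^sub>F e in at_right (0::real). \<forall>h\<in>F. \<forall>q\<in>K. q \<noteq> p \<longrightarrow> p + (e / norm (q - p)) *\<^sub>R (q - p) \<in> h"
  proof (rule eventually_ball_finite[OF F(1)], rule ballI)
    fix h assume h: "h \<in> F"
    then obtain a b where a: "a \<noteq> 0" and ab: "h = {x. a \<bullet> x \<le> b}" using half by blast
    have inside: "a \<bullet> q \<le> b" if "q \<in> K" for q using that F(2) h ab by auto
    show "\<forall>\<^sub>F e in at_right 0. \<forall>q\<in>K. q \<noteq> p \<longrightarrow> p + (e / norm (q - p)) *\<^sub>R (q - p) \<in> h"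
    proof (cases "a \<bullet> p = b")
      case True
      have "p + (e / norm (q - p)) *\<^sub>R (q - p) \<in> h" if "e > 0" "q \<in> K" for e q
      proof -
        have "a \<bullet> (q - p) \<le> 0" using inside[OF that(2)] True by (simp add: inner_diff_right)
        then have "(e / norm (q - p)) * (a \<bullet> (q - p)) \<le> 0"
          using that(1) by (intro mult_nonneg_nonpos) auto
        then show ?thesis using True by (simp add: ab inner_add_right)
      qed
      then show ?thesis using eventually_at_right_less[of "0::real"] by (auto elim: eventually_mono)
    next
      case False
      then have slack: "0 < (b - a \<bullet> p) / norm a" using inside[OF assms(2)] a by simp
      have "p + (e / norm (q - p)) *\<^sub>R (q - p) \<in> h"
        if "0 < e" "e < (b - a \<bullet> p) / norm a" "q \<noteq> p" for e q
      proof -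
        have "a \<bullet> ((e / norm (q - p)) *\<^sub>R (q - p)) \<le> norm a * norm ((e / norm (q - p)) *\<^sub>R (q - p))"
          by (rule norm_cauchy_schwarz)
        also have "\<dots> = norm a * e" using that(1,3) by simp
        also have "\<dots> \<le> b - a \<bullet> p" using that(2) a by (simp add: field_simps)
        finally show ?thesis by (simp add: ab inner_add_right)
      qed
      then have "\<forall>e. 0 < e \<and> e < (b - a \<bullet> p) / norm a \<longrightarrow>
          (\<forall>q\<in>K. q \<noteq> p \<longrightarrow> p + (e / norm (q - p)) *\<^sub>R (q - p) \<in> h)" by blast
      then show ?thesis
        using slack unfolding eventually_at_right_field by blast
    qed
  qed
  then have "\<forall>\<^sub>F e in at_right 0. 0 < e \<and> (\<forall>h\<in>F. \<forall>q\<in>K. q \<noteq> p \<longrightarrow> p + (e / norm (q - p)) *\<^sub>R (q - p) \<in> h)"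
    using eventually_at_right_less[of "0::real"] by (simp add: eventually_conj)
  then obtain e :: real where "0 < e"
    "\<forall>h\<in>F. \<forall>q\<in>K. q \<noteq> p \<longrightarrow> p + (e / norm (q - p)) *\<^sub>R (q - p) \<in> h"
    using eventually_happens'[OF trivial_limit_at_right_real] by blast
  then show ?thesis using F(2) by blast
qed

text \<open>The fibres of a polytope are lower semicontinuous, even with a linear rate. A base point \<open>q\<close>
  close to \<open>p\<close> lies on the segment from \<open>p\<close> to a base point at the fixed distance \<open>e\<close>, with
  \<open>l = dist p q / e\<close> as its parameter. Moving by the same parameter from \<open>x\<close> towards any point \<open>w\<close> over that far
  base point gives a point over \<open>q\<close>, at distance \<open>l * dist x w\<close> from \<open>x\<close>.\<close>

lemma polytope_fibre_calm:
  fixes G :: "('a::euclidean_space \<times> 'b::euclidean_space) set"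
  assumes G: "polytope G" and px: "(p, x) \<in> G"
  shows "\<exists>C. \<forall>q\<in>fst ` G. \<exists>z. (q, z) \<in> G \<and> dist x z \<le> C * dist p q"
proof -
  have "linear (fst :: 'a \<times> 'b \<Rightarrow> 'a)" by (simp add: linear_iff)
  then have "polyhedron (fst ` G)"
    using G polytope_linear_image polytope_imp_polyhedron by blast
  moreover have "p \<in> fst ` G" using px by force
  ultimately have "\<exists>e>0. \<forall>q\<in>fst ` G. q \<noteq> p \<longrightarrow> p + (e / norm (q - p)) *\<^sub>R (q - p) \<in> fst ` G"
    by (rule polyhedron_locally_conic)
  then obtain e where e: "e > 0"
    and conic: "\<And>q. q \<in> fst ` G \<Longrightarrow> q \<noteq> p \<Longrightarrow> p + (e / norm (q - p)) *\<^sub>R (q - p) \<in> fst ` G"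
    by metis
  have "bounded (snd ` G)" using G bounded_snd polytope_imp_bounded by blast
  moreover have "x \<in> snd ` G" using px by force
  ultimately obtain B where "\<And>z. z \<in> snd ` G \<Longrightarrow> dist x z \<le> B"
    by (metis bounded_any_center)
  then have B: "dist x z \<le> B" if "(q, z) \<in> G" for q z using that by force
  then have "B \<ge> 0" using px by force
  have "\<exists>z. (q, z) \<in> G \<and> dist x z \<le> (B / e) * dist p q" if q: "q \<in> fst ` G" for q
  proof (cases "q = p")
    case True
    then show ?thesis using px by auto
  next
    case False
    define l where "l = dist p q / e"
    have l: "l > 0" using False e by (simp add: l_def)
    show ?thesis
    proof (cases "l \<le> 1")
      case True
      obtain w where w: "(p + (e / norm (q - p)) *\<^sub>R (q - p), w) \<in> G"
        using conic[OF q False] by force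
      define z where "z = (1 - l) *\<^sub>R x + l *\<^sub>R w"
      have "l * (e / norm (q - p)) = 1" using False e by (simp add: l_def dist_norm norm_minus_commute)
      then have "l *\<^sub>R (p + (e / norm (q - p)) *\<^sub>R (q - p)) = l *\<^sub>R p + (q - p)"
        by (metis scaleR_add_right scaleR_scaleR scaleR_one)
      then have "(1 - l) *\<^sub>R (p, x) + l *\<^sub>R (p + (e / norm (q - p)) *\<^sub>R (q - p), w) = (q, z)"
        by (simp add: z_def algebra_simps)
      moreover have "(1 - l) *\<^sub>R (p, x) + l *\<^sub>R (p + (e / norm (q - p)) *\<^sub>R (q - p), w) \<in> G"
        using polytope_imp_convex[OF G] px w l True by (intro convexD) auto
      moreover have "dist x z = l * dist x w"
      proof -
        have "x - z = l *\<^sub>R (x - w)" by (simp add: z_def algebra_simps)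
        then show ?thesis using l by (simp add: dist_norm)
      qed
      moreover have "l * dist x w \<le> l * B" using B[OF w] l by (simp add: mult_left_mono)
      ultimately show ?thesis by (auto simp: l_def mult.commute)
    next
      case far: False
      \<comment> \<open>The required bound \<open>B * l\<close> exceeds \<open>B\<close>, so any point of the fibre will do.\<close>
      obtain z where z: "(q, z) \<in> G" using q by force
      have "dist x z \<le> B * 1" using B[OF z] by simp
      also have "\<dots> \<le> B * l" using far \<open>B \<ge> 0\<close> by (intro mult_left_mono) auto
      finally show ?thesis using z by (auto simp: l_def)
    qed
  qed
  then show ?thesis by blast
qed

text \<open>Since the values of \<open>f\<close> stay in a compact set, it is enough that the graph of \<open>f\<close> is closed.
  A limit \<open>(p, y)\<close> of points \<open>(q k, f (q k))\<close> of the graph belongs to \<open>G\<close>; comparing \<open>f (q k)\<close> with points \<open>x k\<close> of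
  the same fibre that tend to \<open>f p\<close> yields \<open>c y \<le> c (f p)\<close>, and uniqueness gives \<open>y = f p\<close>.\<close>

theorem continuous_on_unique_minimizer:
  fixes G :: "('a::euclidean_space \<times> 'b::euclidean_space) set" and c :: "'b \<Rightarrow> real"
  assumes G: "polytope G" and c: "continuous_on UNIV c"
    and f: "\<And>p y. p \<in> S \<Longrightarrow> is_arg_min c (\<lambda>x. (p, x) \<in> G) y \<longleftrightarrow> y = f p"
  shows "continuous_on S f"
proof -
  have inG: "(p, f p) \<in> G" and least: "(p, y) \<in> G \<Longrightarrow> c (f p) \<le> c y" if "p \<in> S" for p y
    using f[OF that, of "f p"] by (auto simp: is_arg_min_linorder)
  have "compact (snd ` G)"
    using G by (intro compact_continuous_image polytope_imp_compact continuous_intros)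
  moreover have "f \<in> S \<rightarrow> snd ` G" using inG by force
  moreover have "closedin (top_of_set (S \<times> snd ` G)) ((\<lambda>p. (p, f p)) ` S)"
    unfolding closedin_limpt
  proof (intro conjI allI impI)
    show "(\<lambda>p. (p, f p)) ` S \<subseteq> S \<times> snd ` G" using inG by force
    fix z assume "z islimpt (\<lambda>p. (p, f p)) ` S \<and> z \<in> S \<times> snd ` G"
    then obtain p y s where z: "z = (p, y)" "p \<in> S"
      and s: "\<And>k. s k \<in> (\<lambda>p. (p, f p)) ` S" "s \<longlonglongrightarrow> z"
      unfolding islimpt_sequential by (metis DiffD1 mem_Sigma_iff surj_pair)
    define q where "q k = fst (s k)" for k
    have sq: "s k = (q k, f (q k))" "q k \<in> S" for k using s(1)[of k] by (auto simp: q_def)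
    have q: "q \<longlonglongrightarrow> p" and fq: "(\<lambda>k. f (q k)) \<longlonglongrightarrow> y"
      using tendsto_fst[OF s(2)] tendsto_snd[OF s(2)] unfolding z(1) sq(1) by simp_all
    have "(p, y) \<in> G"
      using s(2) z(1) sq inG polytope_imp_closed[OF G] by (metis closed_sequentially)
    obtain C where C: "\<And>q. q \<in> fst ` G \<Longrightarrow> \<exists>x. (q, x) \<in> G \<and> dist (f p) x \<le> C * dist p q"
      using polytope_fibre_calm[OF G inG[OF z(2)]] by blast
    have "q k \<in> fst ` G" for k using inG[OF sq(2)] by force
    then have "\<forall>k. \<exists>x. (q k, x) \<in> G \<and> dist (f p) x \<le> C * dist p (q k)" using C by blast
    then obtain x where x: "\<And>k. (q k, x k) \<in> G" "\<And>k. dist (f p) (x k) \<le> C * dist p (q k)"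
      using choice[of "\<lambda>k x. (q k, x) \<in> G \<and> dist (f p) x \<le> C * dist p (q k)"] by blast
    have "(\<lambda>k. C * dist p (q k)) \<longlonglongrightarrow> C * dist p p" by (intro tendsto_intros q)
    then have bound: "(\<lambda>k. C * dist p (q k)) \<longlonglongrightarrow> 0" by simp
    have "\<forall>\<^sub>F k in sequentially. norm (dist (x k) (f p)) \<le> C * dist p (q k)"
      using x(2) by (simp add: dist_commute)
    from this bound have "(\<lambda>k. dist (x k) (f p)) \<longlonglongrightarrow> 0"
      by (rule Lim_null_comparison)
    then have "x \<longlonglongrightarrow> f p" by (rule tendsto_dist_iff[THEN iffD2])
    then have "(\<lambda>k. c (x k)) \<longlonglongrightarrow> c (f p)" "(\<lambda>k. c (f (q k))) \<longlonglongrightarrow> c y"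
      using fq c by (auto intro: continuous_on_tendsto_compose)
    then have "c y \<le> c (f p)"
      using least[OF sq(2) x(1)] by (meson LIMSEQ_le)
    then have "is_arg_min c (\<lambda>x. (p, x) \<in> G) y"
      using \<open>(p, y) \<in> G\<close> least[OF z(2)] by (fastforce simp: is_arg_min_linorder)
    then show "z \<in> (\<lambda>p. (p, f p)) ` S" using f z by auto
  qed
  ultimately show ?thesis by (simp add: continuous_closed_graph_eq)
qed

section \<open>Polyhedra given by affine inequalities\<close>

text \<open>Closure rules for affine functionals let the polyhedrality of a set be read off from the syntactic
  form of the constraints that define it, without normal vectors being computed by hand.\<close>

definition affine_form :: "('a::euclidean_space \<Rightarrow> real) \<Rightarrow> bool" where
  "affine_form f \<longleftrightarrow> (\<exists>a b. \<forall>x. f x = a \<bullet> x + b)"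

lemma affine_form_linear: "linear f \<Longrightarrow> affine_form f"
  unfolding affine_form_def
  by (rule exI[of _ "adjoint f 1"], rule exI[of _ 0]) (simp add: adjoint_works inner_commute)

lemma affine_form_const: "affine_form (\<lambda>x. c)"
  unfolding affine_form_def by (rule exI[of _ 0]) simp

lemma affine_form_add:
  assumes "affine_form f" "affine_form g" shows "affine_form (\<lambda>x. f x + g x)"
proof -
  obtain a b c d where "\<forall>x. f x = a \<bullet> x + b" "\<forall>x. g x = c \<bullet> x + d"
    using assms unfolding affine_form_def by blast
  then show ?thesis unfolding affine_form_def
    by (intro exI[of _ "a + c"] exI[of _ "b + d"]) (simp add: inner_add_left)
qed

lemma affine_form_mult_left:
  assumes "affine_form f" shows "affine_form (\<lambda>x. c * f x)"
proof -
  obtain a b where "\<forall>x. f x = a \<bullet> x + b"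
    using assms unfolding affine_form_def by blast
  then show ?thesis unfolding affine_form_def
    by (intro exI[of _ "c *\<^sub>R a"] exI[of _ "c * b"]) (simp add: distrib_left)
qed

lemma affine_form_mult_right: "affine_form f \<Longrightarrow> affine_form (\<lambda>x. f x * c)"
  using affine_form_mult_left[of f c] by (simp add: mult.commute)

lemma affine_form_diff: "affine_form f \<Longrightarrow> affine_form g \<Longrightarrow> affine_form (\<lambda>x. f x - g x)"
  using affine_form_add[of f "\<lambda>x. - 1 * g x"] affine_form_mult_left[of g "- 1"] by simp

lemma affine_form_sum:
  assumes "\<And>i. i \<in> A \<Longrightarrow> affine_form (f i)" shows "affine_form (\<lambda>x. \<Sum>i\<in>A. f i x)"
  using assms by (induction A rule: infinite_finite_induct)
    (simp_all add: affine_form_const affine_form_add)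

lemmas affine_form_intros =
  affine_form_const affine_form_add affine_form_diff affine_form_mult_left
  affine_form_mult_right affine_form_sum

lemma polyhedron_affine_le:
  assumes "affine_form f" "affine_form g" shows "polyhedron {x. f x \<le> g x}"
proof -
  obtain a b where "\<forall>x. f x - g x = a \<bullet> x + b"
    using affine_form_diff[OF assms] unfolding affine_form_def by blast
  then have "{x. f x \<le> g x} = {x. a \<bullet> x \<le> - b}"
    by (auto simp: algebra_simps)
  then show ?thesis by (simp add: polyhedron_halfspace_le)
qed

lemma polyhedron_Collect_conj:
  "polyhedron {x. P x} \<Longrightarrow> polyhedron {x. Q x} \<Longrightarrow> polyhedron {x. P x \<and> Q x}"
  by (simp add: Collect_conj_eq)

lemma polyhedron_affine_eq:
  "affine_form f \<Longrightarrow> affine_form g \<Longrightarrow> polyhedron {x. f x = g x}"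
  unfolding order_eq_iff by (intro polyhedron_Collect_conj polyhedron_affine_le)

lemma polyhedron_Collect_imp:
  "(c \<Longrightarrow> polyhedron {x. P x}) \<Longrightarrow> polyhedron {x. c \<longrightarrow> P x}"
  by (cases c) auto

lemma polyhedron_Collect_all:
  fixes P :: "'i::finite \<Rightarrow> 'a::euclidean_space \<Rightarrow> bool"
  assumes "\<And>i. polyhedron {x. P i x}" shows "polyhedron {x. \<forall>i. P i x}"
proof -
  have "{x. \<forall>i. P i x} = \<Inter>(range (\<lambda>i. {x. P i x}))" by auto
  then show ?thesis using assms by (auto intro: polyhedron_Inter)
qed

section \<open>The lower-level problem\<close>

text \<open>The graph of the constraint map \<open>P' \<mapsto> {P. feasible D t I P' P}\<close> once the set \<open>A\<close> of previously
  committed units is prescribed instead of read off from \<open>P'\<close>. Previous power \<open>0\<close> switches all ramp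
  limits off, so \<open>feasible D t I 0\<close> collects the constraints that do not involve \<open>P'\<close>. The first
  component of a pair is \<open>P'\<close>, the second \<open>P\<close>.\<close>

definition dispatch_graph ::
    "'n::finite uc_data \<Rightarrow> nat \<Rightarrow> 'n commitment \<Rightarrow> 'n set \<Rightarrow> ('n power \<times> 'n power) set" where
  "dispatch_graph D t I A = {z. feasible D t I 0 (snd z) \<and>
     (\<forall>n. I $ n = 1 \<and> n \<in> A \<longrightarrow>
        - ramp_down D n \<le> P_th (snd z) n - P_th (fst z) n \<and>
        P_th (snd z) n - P_th (fst z) n \<le> ramp_up D n)}"

lemma feasible_iff_dispatch_graph:
  "feasible D t I P' P \<longleftrightarrow> (P', P) \<in> dispatch_graph D t I {n. P_th P' n > 0}"
  unfolding feasible_def dispatch_graph_def by auto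

lemma polyhedron_dispatch_graph:
  fixes D :: "'n::finite uc_data"
  shows "polyhedron (dispatch_graph D t I A)"
proof -
  have lin: "affine_form (\<lambda>z :: 'n power \<times> 'n power. P_th (fst z) n)"
    "affine_form (\<lambda>z :: 'n power \<times> 'n power. P_th (snd z) n)"
    "affine_form (\<lambda>z :: 'n power \<times> 'n power. P_DG (snd z))"
    "affine_form (\<lambda>z :: 'n power \<times> 'n power. P_DR (snd z))" for n
    by (intro affine_form_linear; simp add: linear_iff)+
  show ?thesis
    unfolding dispatch_graph_def feasible_def fst_zero zero_index less_irrefl simp_thms
    by (intro polyhedron_Collect_conj polyhedron_Collect_all polyhedron_Collect_imp
        polyhedron_affine_le polyhedron_affine_eq affine_form_intros lin)
qed

text \<open>Ramp limits alone do not bound the previous power vector, so the graph above can be unbounded.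
  Intersecting it with such boxes in both components makes it a polytope and loses no pair that occurs
  in the dynamics.\<close>

definition power_box :: "'n::finite uc_data \<Rightarrow> nat \<Rightarrow> 'n power set" where
  "power_box D t = cbox (0, 0, 0) (\<chi> n. P_max D n, DG_max D t, DR_max D t)"

lemma feasible_imp_power_box:
  assumes "uc_data_valid D" "I \<in> commitments" "feasible D t I P' P"
  shows "P \<in> power_box D t"
proof -
  have "0 \<le> P_th P n \<and> P_th P n \<le> P_max D n" for n
  proof -
    have "I $ n = 0 \<or> I $ n = 1" using assms(2) by (auto simp: commitments_def)
    moreover have "I $ n * P_min D n \<le> P_th P n" "P_th P n \<le> I $ n * P_max D n"
      using assms(3) by (auto simp: feasible_def)
    moreover have "0 < P_min D n" "P_min D n \<le> P_max D n"
      using assms(1) by (auto simp: uc_data_valid_def)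
    ultimately show ?thesis by auto
  qed
  moreover have "0 \<le> P_DG P" "P_DG P \<le> DG_max D t" "0 \<le> P_DR P" "P_DR P \<le> DR_max D t"
    using assms(3) by (auto simp: feasible_def)
  ultimately show ?thesis
    by (cases P) (auto simp: power_box_def cbox_Pair_eq mem_box_cart)
qed

text \<open>The parallelogram identity \<open>q ((x + y) / 2) = (q x + q y) / 2 - a (x - y)\<^sup>2 / 4\<close> for a
  quadratic \<open>q\<close> with leading coefficient \<open>a\<close>, summed over all components.\<close>

lemma running_cost_midpoint:
  "running_cost D ((1/2) *\<^sub>R X + (1/2) *\<^sub>R Y) I =
     (running_cost D X I + running_cost D Y I) / 2 -
     ((\<Sum>n\<in>UNIV. I $ n * (fuel_a D n + emission_price D * em_alpha D n) * (P_th X n - P_th Y n)\<^sup>2)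
       + a_DG D * (P_DG X - P_DG Y)\<^sup>2 + a_DR D * (P_DR X - P_DR Y)\<^sup>2) / 4"
proof -
  let ?u = "\<lambda>P n. I $ n * (fuel_cost D n (P_th P n) + emission_price D * emission D n (P_th P n))
        - 1 / real (horizon D) * quota D n * emission_price D"
  have "(\<Sum>n\<in>UNIV. ?u ((1/2) *\<^sub>R X + (1/2) *\<^sub>R Y) n) =
    (\<Sum>n\<in>UNIV. (?u X n + ?u Y n) / 2 -
       (I $ n * (fuel_a D n + emission_price D * em_alpha D n) * (P_th X n - P_th Y n)\<^sup>2) / 4)"
    by (rule sum.cong) (simp_all add: fuel_cost_def emission_def power2_eq_square field_simps)
  also have "\<dots> = ((\<Sum>n\<in>UNIV. ?u X n) + (\<Sum>n\<in>UNIV. ?u Y n)) / 2 -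
      (\<Sum>n\<in>UNIV. I $ n * (fuel_a D n + emission_price D * em_alpha D n) * (P_th X n - P_th Y n)\<^sup>2) / 4"
    by (simp only: sum_subtractf sum.distrib sum_divide_distrib[symmetric])
  finally have thermal: "(\<Sum>n\<in>UNIV. ?u ((1/2) *\<^sub>R X + (1/2) *\<^sub>R Y) n) =
      ((\<Sum>n\<in>UNIV. ?u X n) + (\<Sum>n\<in>UNIV. ?u Y n)) / 2 -
      (\<Sum>n\<in>UNIV. I $ n * (fuel_a D n + emission_price D * em_alpha D n) * (P_th X n - P_th Y n)\<^sup>2) / 4" .
  have "DG_cost D (P_DG ((1/2) *\<^sub>R X + (1/2) *\<^sub>R Y)) =
      (DG_cost D (P_DG X) + DG_cost D (P_DG Y)) / 2 - a_DG D * (P_DG X - P_DG Y)\<^sup>2 / 4"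
    by (simp add: DG_cost_def power2_eq_square field_simps)
  note DG = this
  have DR: "DR_cost D (P_DR ((1/2) *\<^sub>R X + (1/2) *\<^sub>R Y)) =
      (DR_cost D (P_DR X) + DR_cost D (P_DR Y)) / 2 - a_DR D * (P_DR X - P_DR Y)\<^sup>2 / 4"
    by (simp add: DR_cost_def power2_eq_square field_simps)
  have collect: "(x + y) / 2 - s / 4 + ((d + d') / 2 - e / 4) + ((r + r') / 2 - g / 4) =
      (x + d + r + (y + d' + r')) / 2 - (s + e + g) / 4" for x y s d d' e r r' g :: real
    by (simp add: field_simps)
  show ?thesis unfolding running_cost_def thermal DG DR by (rule collect)
qed

text \<open>The running cost is not strictly convex as it stands: it ignores the output of uncommitted units.
  The capacity constraint forces these outputs to be \<open>0\<close>, and in the remaining components the defect in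
  the midpoint identity is positive definite.\<close>

lemma optimal_unique:
  assumes valid: "uc_data_valid D" and I: "I \<in> commitments"
    and X: "optimal D t I P' X" and Y: "optimal D t I P' Y"
  shows "X = Y"
proof -
  have feas: "feasible D t I P' X" "feasible D t I P' Y"
    and least: "\<And>Z. feasible D t I P' Z \<Longrightarrow> running_cost D X I \<le> running_cost D Z I"
      "\<And>Z. feasible D t I P' Z \<Longrightarrow> running_cost D Y I \<le> running_cost D Z I"
    using X Y by (auto simp: optimal_def is_arg_min_linorder)
  define M where "M = (1/2) *\<^sub>R X + (1/2) *\<^sub>R Y"
  let ?th = "\<lambda>n. I $ n * (fuel_a D n + emission_price D * em_alpha D n) * (P_th X n - P_th Y n)\<^sup>2"
  have I01: "I $ n = 0 \<or> I $ n = 1" for n using I by (auto simp: commitments_def)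
  have pos: "0 < fuel_a D n + emission_price D * em_alpha D n" "0 < a_DG D" "0 < a_DR D" for n
    using valid by (auto simp: uc_data_valid_def add_pos_nonneg less_imp_le)
  have "(1/2) *\<^sub>R (P', X) + (1/2) *\<^sub>R (P', Y) = (P', M)"
    by (simp add: M_def flip: scaleR_add_left)
  then have "feasible D t I P' M"
    using feas convexD[OF polyhedron_imp_convex[OF polyhedron_dispatch_graph], of "(P', X)" D t I _ "(P', Y)" "1/2" "1/2"]
    by (simp add: feasible_iff_dispatch_graph)
  then have le: "sum ?th UNIV + a_DG D * (P_DG X - P_DG Y)\<^sup>2 + a_DR D * (P_DR X - P_DR Y)\<^sup>2 \<le> 0"
  proof -
    have "e \<le> 0" if "m = (x + y) / 2 - e / 4" "x \<le> m" "y \<le> m" for m x y e :: real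
      using that by argo
    from this[OF running_cost_midpoint] show ?thesis
      using least(1,2)[OF \<open>feasible D t I P' M\<close>] unfolding M_def by blast
  qed
  have th_nonneg: "0 \<le> ?th n" for n using I01[of n] pos(1)[of n] by auto
  then have "0 \<le> sum ?th UNIV" by (intro sum_nonneg)
  moreover have "0 \<le> a_DG D * (P_DG X - P_DG Y)\<^sup>2" "0 \<le> a_DR D * (P_DR X - P_DR Y)\<^sup>2"
    using pos by auto
  ultimately have "sum ?th UNIV = 0" "a_DG D * (P_DG X - P_DG Y)\<^sup>2 = 0" "a_DR D * (P_DR X - P_DR Y)\<^sup>2 = 0"
    using le by linarith+
  then have DG: "P_DG X = P_DG Y" and DR: "P_DR X = P_DR Y" and th0: "\<forall>n\<in>UNIV. ?th n = 0"
    using th_nonneg pos(2,3) sum_nonneg_eq_0_iff[of UNIV ?th] by auto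
  have "P_th X n = P_th Y n" for n
  proof (cases "I $ n = 0")
    case True
    then have "P_th X n \<le> 0" "0 \<le> P_th X n" "P_th Y n \<le> 0" "0 \<le> P_th Y n"
      using feas by (auto simp: feasible_def dest!: spec[of _ n])
    then show ?thesis by linarith
  next
    case False
    moreover have "?th n = 0" using th0 by blast
    ultimately show ?thesis using pos(1)[of n] by simp
  qed
  then have "fst X = fst Y" by (simp add: vec_eq_iff)
  then show ?thesis using DG DR by (simp add: prod_eq_iff)
qed

lemma optimal_iff_subsystem:
  assumes "uc_data_valid D" "I \<in> commitment_set D (Suc t)" "P' \<in> power_set D t"
  shows "optimal D (Suc t) I P' P \<longleftrightarrow> P = subsystem D (Suc t) I P'"
proof -
  have "I \<in> commitments" and "\<exists>P. optimal D (Suc t) I P' P" using assms(2,3) by auto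
  then have "\<exists>!P. optimal D (Suc t) I P' P" using optimal_unique[OF assms(1)] by blast
  then show ?thesis unfolding subsystem_def by (metis the1_equality theI')
qed

lemma subsystem_in_power_set:
  assumes "uc_data_valid D" "I \<in> commitment_set D (Suc t)" "P' \<in> power_set D t"
  shows "subsystem D (Suc t) I P' \<in> power_set D (Suc t)"
proof -
  have "feasible D (Suc t) I P' (subsystem D (Suc t) I P')"
    using optimal_iff_subsystem[OF assms, of "subsystem D (Suc t) I P'"]
    by (simp add: optimal_def is_arg_min_def)
  then show ?thesis unfolding power_set.simps using assms(2,3) by blast
qed

lemma power_set_feasible:
  assumes "P \<in> power_set D t" "0 < t"
  obtains I P' where "I \<in> commitments" "feasible D t I P' P"
proof -
  obtain s where "t = Suc s" using assms(2) gr0_implies_Suc by blast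
  then show ?thesis using assms(1) that by auto
qed

text \<open>This gap between \<open>0\<close> and the minimal capacity makes the sign pattern of the thermal outputs
  locally constant on the feasible sets.\<close>

lemma power_set_committed_iff:
  assumes "uc_data_valid D" "P \<in> power_set D t" "0 < t"
  shows "0 < P_th P n \<longleftrightarrow> P_min D n \<le> P_th P n"
proof -
  obtain I P' where I: "I \<in> commitments" and feas: "feasible D t I P' P"
    using power_set_feasible[OF assms(2,3)] .
  have "I $ n = 0 \<or> I $ n = 1" using I by (auto simp: commitments_def)
  moreover have "I $ n * P_min D n \<le> P_th P n" "P_th P n \<le> I $ n * P_max D n"
    using feas by (auto simp: feasible_def)
  moreover have "0 < P_min D n" using assms(1) by (auto simp: uc_data_valid_def)
  ultimately show ?thesis by auto
qed

lemma continuous_running_cost: "continuous_on S (\<lambda>P. running_cost D P I)"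
  unfolding running_cost_def fuel_cost_def emission_def DG_cost_def DR_cost_def
  by (intro continuous_intros)

text \<open>On the set \<open>S A\<close> of feasible vectors whose positive outputs are those of the units in \<open>A\<close>, the
  subsystem map is a unique minimizer over the fibres of a polytope. These sets are relatively open in
  the feasible set, so continuity on each of them suffices.\<close>

lemma continuous_subsystem:
  fixes D :: "'n::finite uc_data"
  assumes valid: "uc_data_valid D" and t: "0 < t" and I: "I \<in> commitment_set D (Suc t)"
  shows "continuous_on (power_set D t) (subsystem D (Suc t) I)"
proof -
  have Icom: "I \<in> commitments" using I by simp
  define S where "S A = power_set D t \<inter> {P. {n. 0 < P_th P n} = A}" for A
  have piece: "continuous_on (S A) (subsystem D (Suc t) I)" for A
  proof (rule continuous_on_unique_minimizer)
    let ?G = "dispatch_graph D (Suc t) I A \<inter> power_box D t \<times> power_box D (Suc t)"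
    have "polytope (power_box D t \<times> power_box D (Suc t))"
      unfolding power_box_def cbox_Pair_eq[symmetric] by (rule polytope_interval)
    then show "polytope ?G"
      using polyhedron_dispatch_graph polyhedron_Int_polytope by blast
    show "continuous_on UNIV (\<lambda>P. running_cost D P I)" by (rule continuous_running_cost)
    fix p y assume "p \<in> S A"
    then have p: "p \<in> power_set D t" "{n. 0 < P_th p n} = A" by (auto simp: S_def)
    have "p \<in> power_box D t"
      using power_set_feasible[OF p(1) t] feasible_imp_power_box[OF valid] by metis
    then have "(p, x) \<in> ?G \<longleftrightarrow> feasible D (Suc t) I p x" for x
      using feasible_imp_power_box[OF valid Icom, of "Suc t" p x]
        feasible_iff_dispatch_graph[of D "Suc t" I p x] p(2) by auto
    then show "is_arg_min (\<lambda>P. running_cost D P I) (\<lambda>x. (p, x) \<in> ?G) y \<longleftrightarrow>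
        y = subsystem D (Suc t) I p"
      using optimal_iff_subsystem[OF valid I p(1), of y] by (simp add: optimal_def)
  qed
  show ?thesis
    unfolding continuous_on_eq_continuous_within
  proof
    fix P assume P: "P \<in> power_set D t"
    let ?A = "{n. 0 < P_th P n}"
    \<comment> \<open>An open set that meets the feasible set exactly in \<open>S ?A\<close>, by the capacity gap.\<close>
    define U :: "'n power set" where
      "U = (\<Inter>n\<in>?A. {X. 0 < P_th X n}) \<inter> (\<Inter>n\<in>-?A. {X. P_th X n < P_min D n})"
    have "open U" unfolding U_def
      by (intro open_Int open_INT finite ballI open_Collect_less continuous_intros)
    moreover have U_iff: "X \<in> U \<longleftrightarrow> {n. 0 < P_th X n} = ?A" if "X \<in> power_set D t" for X
    proof -
      have "P_th X n < P_min D n \<longleftrightarrow> \<not> 0 < P_th X n" for n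
        using power_set_committed_iff[OF valid that t] by (simp add: not_le)
      then show ?thesis unfolding U_def by auto
    qed
    moreover have "P \<in> U" using U_iff[OF P] by simp
    moreover have "power_set D t \<inter> U = S ?A \<inter> U" using U_iff by (auto simp: S_def)
    ultimately have "at P within power_set D t = at P within S ?A"
      by (intro at_within_nhd[of _ U]) auto
    moreover have "P \<in> S ?A" using P by (simp add: S_def)
    ultimately show "continuous (at P within power_set D t) (subsystem D (Suc t) I)"
      using piece by (simp add: continuous_on_eq_continuous_within)
  qed
qed

section \<open>Dynamic programming\<close>

lemma continuous_on_Min_image:
  fixes f :: "'i \<Rightarrow> 'a::topological_space \<Rightarrow> real"
  assumes "finite A" "A \<noteq> {}" "\<And>i. i \<in> A \<Longrightarrow> continuous_on S (f i)"
  shows "continuous_on S (\<lambda>x. Min ((\<lambda>i. f i x) ` A))"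
  using assms
proof (induction A rule: finite_ne_induct)
  case (insert i A)
  have "continuous_on S (\<lambda>x. min (f i x) (Min ((\<lambda>i. f i x) ` A)))"
    using insert by (intro continuous_on_min) auto
  then show ?case using insert.hyps by simp
qed simp

lemma finite_commitments: "finite (commitments :: 'n::finite commitment set)"
proof -
  have "(commitments :: 'n commitment set) \<subseteq> vec_lambda ` (UNIV \<rightarrow>\<^sub>E {0, 1 :: real})"
  proof
    fix I :: "'n commitment" assume "I \<in> commitments"
    then show "I \<in> vec_lambda ` (UNIV \<rightarrow>\<^sub>E {0, 1})"
      by (intro image_eqI[of _ _ "vec_nth I"]) (auto simp: commitments_def)
  qed
  then show ?thesis by (rule finite_subset) (intro finite_imageI finite_PiE; simp)
qed

lemma finite_admissible: "0 < t \<Longrightarrow> finite (admissible D t)"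
  by (rule finite_subset[OF _ finite_commitments]) (cases t; auto simp: admissible_def)

text \<open>The induction starts one step after the horizon, where the cost-to-go vanishes. At the horizon
  itself the subsystem map need not be continuous, or even meaningful, but it enters only through
  this zero function.\<close>

lemma continuous_cost_to_go:
  assumes valid: "uc_data_valid D"
    and ne: "\<And>s. s \<in> {1..horizon D} \<Longrightarrow> admissible D s \<noteq> {}"
    and "0 < t" "t \<le> Suc (horizon D)"
  shows "continuous_on (power_set D t) (\<lambda>P. cost_to_go D t P I')"
  using assms(4)
proof (induction arbitrary: I' rule: inc_induct)
  case base
  then show ?case by (simp add: cost_to_go.simps)
next
  case (step t)
  then have t: "0 < t" "t \<le> horizon D" using assms(3) by auto
  have "continuous_on (power_set D t) (\<lambda>P. cost_to_go D (Suc t) (subsystem D (Suc t) I P) I)"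
    if "I \<in> admissible D t" for I
  proof (cases "t < horizon D")
    case True
    then have I: "I \<in> commitment_set D (Suc t)" using that by (simp add: admissible_def)
    show ?thesis
      using subsystem_in_power_set[OF valid I]
      by (intro continuous_on_compose2[OF step.IH continuous_subsystem[OF valid t(1) I]]) auto
  next
    case False
    then show ?thesis by (simp add: cost_to_go.simps)
  qed
  then have "continuous_on (power_set D t) (\<lambda>P. Min ((\<lambda>I. running_cost D P I + switching_cost D I' I
                   + cost_to_go D (Suc t) (subsystem D (Suc t) I P) I) ` admissible D t))"
    using t ne[of t]
    by (intro continuous_on_Min_image finite_admissible continuous_on_add continuous_running_cost
        continuous_on_const) auto
  then show ?case using t(2) by (simp add: cost_to_go.simps[of D t])
qed

theorem theorem3:
  fixes D :: "'n::finite uc_data" and t :: nat and I' :: "'n commitment"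
  assumes "uc_data_valid D"
    and "\<And>s. s \<in> {1..horizon D} \<Longrightarrow> admissible D s \<noteq> {}"
    and "t \<in> {1..horizon D}"
    and "I' \<in> commitment_set D (t - 1)"
  shows "continuous_on (power_set D t) (\<lambda>P. cost_to_go D t P I')"
  using continuous_cost_to_go[OF assms(1,2)] assms(3) by simp

end
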